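(* Let $\mathbf{HGr}$ be the category of finite hypergraphs and injective hypergraph homomorphisms, let $\Omega_n=([n],2^{[n]})$ for $n\in\mathbb{N}$, and let $\mathfrak{P}$ assign to each span $H_1\xleftarrow{h_1}\Omega_n\xrightarrow{h_2}H_2$ in $\mathbf{HGr}$ the cocone $H_1\to\mathfrak{P}(h_1,h_2)\leftarrow H_2$, where $\mathfrak{P}(h_1,h_2)$ has vertex set $(V(H_1)\uplus V(H_2))/_{h_1=h_2}$ (identify $h_1(v)$ with $h_2(v)$ for each $v\in[n]$) and edge set $(E(H_1)\uplus E(H_2))/_{h_1=h_2}$ (the images of the hyperedges of $H_1$ and $H_2$ in the quotient vertex set, coinciding images identified), and the maps send each vertex of $H_i$ to its class. Then $(\mathbf{HGr},\Omega,\mathfrak{P})$ is a spined category.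
   Context: $\mathbb{N}=\{0,1,\dots\}$, $[n]=\{1,\dots,n\}$. A hypergraph is $H=(V(H),E(H))$ with $V(H)$ finite and $E(H)$ a set of subsets of $V(H)$; a hypergraph homomorphism $h:H_1\to H_2$ is a map on vertices with $h(F)\in E(H_2)$ for all $F\in E(H_1)$. A spined category is a triple $(\mathcal{C},\Omega,\mathfrak{P})$: a category $\mathcal{C}$, a sequence of objects $(\Omega_n)_{n\in\mathbb{N}}$, and an operation $\mathfrak{P}$ assigning to each span $G\xleftarrow{g}\Omega_n\xrightarrow{h}H$ an object $\mathfrak{P}(g,h)$ and morphisms $\mathfrak{P}(g,h)_g:G\to\mathfrak{P}(g,h)$, $\mathfrak{P}(g,h)_h:H\to\mathfrak{P}(g,h)$ with $\mathfrak{P}(g,h)_gg=\mathfrak{P}(g,h)_hh$, such that (SC1) every object $X$ has a morphism $X\to\Omega_n$ for some $n$; (SC2) for every such span and all $g':G\to G'$, $h':H\to H'$ there is a unique morphism $(g',h'):\mathfrak{P}(g,h)\to\mathfrak{P}(g'g,h'h)$ with $(g',h')\mathfrak{P}(g,h)_g=\mathfrak{P}(g'g,h'h)_{g'g}g'$ and $(g',h')\mathfrak{P}(g,h)_h=\mathfrak{P}(g'g,h'h)_{h'h}h'$. *)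

theory Defs
  imports Main "HOL-Library.FSet" "HOL-Library.FuncSet"
begin

section \<open>Categories\<close>

record ('o, 'm) category =
  Obj :: "'o set"
  Arr :: "'m set"
  Dom :: "'m \<Rightarrow> 'o"
  Cod :: "'m \<Rightarrow> 'o"
  Id :: "'o \<Rightarrow> 'm"
  Comp :: "'m \<Rightarrow> 'm \<Rightarrow> 'm" (infixr "\<cdot>\<index>" 70)

definition Hom :: "('o, 'm, 'z) category_scheme \<Rightarrow> 'o \<Rightarrow> 'o \<Rightarrow> 'm set" where
  "Hom C X Y = {f \<in> Arr C. Dom C f = X \<and> Cod C f = Y}"

locale category =
  fixes C :: "('o, 'm) category" (structure)
  assumes Dom_Obj: "f \<in> Arr C \<Longrightarrow> Dom C f \<in> Obj C"
    and Cod_Obj: "f \<in> Arr C \<Longrightarrow> Cod C f \<in> Obj C"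
    and Id_Hom: "X \<in> Obj C \<Longrightarrow> Id C X \<in> Hom C X X"
    and Comp_Hom: "f \<in> Hom C X Y \<Longrightarrow> g \<in> Hom C Y Z \<Longrightarrow> g \<cdot> f \<in> Hom C X Z"
    and Comp_Id_right: "f \<in> Hom C X Y \<Longrightarrow> f \<cdot> Id C X = f"
    and Comp_Id_left: "f \<in> Hom C X Y \<Longrightarrow> Id C Y \<cdot> f = f"
    and Comp_assoc: "f \<in> Hom C W X \<Longrightarrow> g \<in> Hom C X Y \<Longrightarrow> h \<in> Hom C Y Z \<Longrightarrow>
      h \<cdot> (g \<cdot> f) = (h \<cdot> g) \<cdot> f"

section \<open>Spined categories\<close>

record ('o, 'm) cocone =
  apex :: 'o
  leg1 :: 'm
  leg2 :: 'm

text \<open>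
  A span is given by its two arrows, which determine their (co)domains. The values of
  \<open>P\<close> on pairs of arrows that do not form a span out of some \<open>\<Omega> n\<close> are irrelevant.
\<close>

locale spined_category = category C
  for C :: "('o, 'm) category" (structure) +
  fixes \<Omega> :: "nat \<Rightarrow> 'o"
    and P :: "'m \<Rightarrow> 'm \<Rightarrow> ('o, 'm) cocone"
  assumes spine_Obj: "\<Omega> n \<in> Obj C"
    and apex_Obj: "g \<in> Hom C (\<Omega> n) G \<Longrightarrow> h \<in> Hom C (\<Omega> n) H \<Longrightarrow> apex (P g h) \<in> Obj C"
    and leg1_Hom: "g \<in> Hom C (\<Omega> n) G \<Longrightarrow> h \<in> Hom C (\<Omega> n) H \<Longrightarrow>
      leg1 (P g h) \<in> Hom C G (apex (P g h))"
    and leg2_Hom: "g \<in> Hom C (\<Omega> n) G \<Longrightarrow> h \<in> Hom C (\<Omega> n) H \<Longrightarrow>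
      leg2 (P g h) \<in> Hom C H (apex (P g h))"
    and cocone_commutes: "g \<in> Hom C (\<Omega> n) G \<Longrightarrow> h \<in> Hom C (\<Omega> n) H \<Longrightarrow>
      leg1 (P g h) \<cdot> g = leg2 (P g h) \<cdot> h"
    and SC1: "X \<in> Obj C \<Longrightarrow> \<exists>n f. f \<in> Hom C X (\<Omega> n)"
    and SC2: "g \<in> Hom C (\<Omega> n) G \<Longrightarrow> h \<in> Hom C (\<Omega> n) H \<Longrightarrow>
      g' \<in> Hom C G G' \<Longrightarrow> h' \<in> Hom C H H' \<Longrightarrow>
      \<exists>!k. k \<in> Hom C (apex (P g h)) (apex (P (g' \<cdot> g) (h' \<cdot> h))) \<and>
           k \<cdot> leg1 (P g h) = leg1 (P (g' \<cdot> g) (h' \<cdot> h)) \<cdot> g' \<and>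
           k \<cdot> leg2 (P g h) = leg2 (P (g' \<cdot> g) (h' \<cdot> h)) \<cdot> h'"

section \<open>Hypergraphs\<close>

datatype 'v hypergraph = Hypergraph (verts: "'v set") (edges: "'v set set")

definition finite_hypergraph :: "'v hypergraph \<Rightarrow> bool" where
  "finite_hypergraph H \<longleftrightarrow> finite (verts H) \<and> edges H \<subseteq> Pow (verts H)"

definition hypergraph_hom :: "'v hypergraph \<Rightarrow> 'w hypergraph \<Rightarrow> ('v \<Rightarrow> 'w) \<Rightarrow> bool" where
  "hypergraph_hom H1 H2 h \<longleftrightarrow> h \<in> verts H1 \<rightarrow> verts H2 \<and> (\<forall>F \<in> edges H1. h ` F \<in> edges H2)"

text \<open>
  The objects of one category must have their vertices in a single type, which here has to be
  closed under forming \<open>(V\<^sub>1 \<uplus> V\<^sub>2)/\<sim>\<close>. The universe \<open>'a vertex\<close> contains arbitrary atoms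
  \<open>'a\<close> (so every finite hypergraph over any type \<open>'a\<close> is, via \<open>Atom\<close>, an object), the numbers
  needed for \<open>\<Omega>\<^sub>n\<close>, and every finite set of elements of its own binary disjoint union, \<open>Class\<close>
  being used for equivalence classes.
\<close>

datatype 'a vertex = Atom 'a | Num nat | Class "('a vertex + 'a vertex) fset"

text \<open>
  An arrow carries its domain and codomain. Its vertex map is required to be extensional, so
  that equality of arrows is equality of maps on the vertices of the domain.
\<close>

datatype 'v hg_arrow = Arrow (src: "'v hypergraph") (vmap: "'v \<Rightarrow> 'v") (tgt: "'v hypergraph")

definition HGr :: "('a vertex hypergraph, 'a vertex hg_arrow) category" where
  "HGr = \<lparr>
     Obj = {H. finite_hypergraph H},
     Arr = {f. finite_hypergraph (src f) \<and> finite_hypergraph (tgt f) \<and>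
               hypergraph_hom (src f) (tgt f) (vmap f) \<and>
               inj_on (vmap f) (verts (src f)) \<and>
               vmap f \<in> extensional (verts (src f))},
     Dom = src,
     Cod = tgt,
     Id = (\<lambda>H. Arrow H (\<lambda>v \<in> verts H. v) H),
     Comp = (\<lambda>g f. Arrow (src f) (compose (verts (src f)) (vmap g) (vmap f)) (tgt g)) \<rparr>"

definition \<Omega>HGr :: "nat \<Rightarrow> 'a vertex hypergraph" where
  "\<Omega>HGr n = Hypergraph (Num ` {1..n}) (Pow (Num ` {1..n}))"

text \<open>The equivalence relation generated by identifying \<open>h\<^sub>1 v\<close> with \<open>h\<^sub>2 v\<close> for \<open>v \<in> S\<close>.\<close>

definition glue_rel :: "'u set \<Rightarrow> ('u \<Rightarrow> 'v) \<Rightarrow> ('u \<Rightarrow> 'w) \<Rightarrow> ('v + 'w) rel" where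
  "glue_rel S h1 h2 =
     (let R = {(Inl (h1 v), Inr (h2 v)) | v. v \<in> S} in (R \<union> R\<inverse>)\<^sup>*)"

definition glue_class ::
  "'a vertex hg_arrow \<Rightarrow> 'a vertex hg_arrow \<Rightarrow> 'a vertex + 'a vertex \<Rightarrow> 'a vertex" where
  "glue_class h1 h2 x = Class (Abs_fset (glue_rel (verts (src h1)) (vmap h1) (vmap h2) `` {x}))"

definition glue :: "'a vertex hg_arrow \<Rightarrow> 'a vertex hg_arrow \<Rightarrow> 'a vertex hypergraph" where
  "glue h1 h2 = Hypergraph
     (glue_class h1 h2 ` (verts (tgt h1) <+> verts (tgt h2)))
     ({glue_class h1 h2 ` Inl ` F | F. F \<in> edges (tgt h1)} \<union>
      {glue_class h1 h2 ` Inr ` F | F. F \<in> edges (tgt h2)})"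

definition PHGr ::
  "'a vertex hg_arrow \<Rightarrow> 'a vertex hg_arrow \<Rightarrow> ('a vertex hypergraph, 'a vertex hg_arrow) cocone" where
  "PHGr h1 h2 = \<lparr>
     apex = glue h1 h2,
     leg1 = Arrow (tgt h1) (\<lambda>v \<in> verts (tgt h1). glue_class h1 h2 (Inl v)) (glue h1 h2),
     leg2 = Arrow (tgt h2) (\<lambda>v \<in> verts (tgt h2). glue_class h1 h2 (Inr v)) (glue h1 h2) \<rparr>"

end

theory Submission imports Defs begin

text \<open>
  Because both legs of a span are injective, the relation gluing them needs no transitive closure:
  a vertex of \<open>H\<^sub>1\<close> is identified with at most one vertex of \<open>H\<^sub>2\<close> and conversely. Hence the two
  maps into the glued hypergraph are injective, and two vertices coming from different sides
  coincide exactly when they are the two images of one vertex of \<open>\<Omega>\<^sub>n\<close>. Since the latter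
  condition is both preserved and reflected by injective maps \<open>g'\<close> and \<open>h'\<close>, the map
  \<open>g' \<uplus> h'\<close> descends to an injective map of the quotients, and it is unique because the two maps
  into the quotient are jointly surjective.
\<close>

section \<open>The gluing relation of two injective maps\<close>

lemma glue_rel_eq:
  assumes "inj_on h1 S" "inj_on h2 S"
  defines "R \<equiv> {(Inl (h1 v), Inr (h2 v)) | v. v \<in> S}"
  shows "glue_rel S h1 h2 = (R \<union> R\<inverse>)\<^sup>="
proof -
  \<comment> \<open>By injectivity a vertex has at most one partner on the other side, so two
    consecutive steps of \<open>R \<union> R\<inverse>\<close> lead back to their start.\<close>
  have "trans ((R \<union> R\<inverse>)\<^sup>=)"
    using assms(1,2) by (auto simp: R_def trans_def dest: inj_onD)
  then have "((R \<union> R\<inverse>)\<^sup>=)\<^sup>* = (R \<union> R\<inverse>)\<^sup>="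
    by (simp add: rtrancl_trancl_reflcl trancl_id sup_assoc del: rtrancl_reflcl reflcl_trancl)
  then show ?thesis
    by (simp add: glue_rel_def R_def Let_def)
qed

lemma equiv_glue_rel: "equiv UNIV (glue_rel S h1 h2)"
  unfolding glue_rel_def Let_def
  by (intro equivI refl_rtrancl sym_rtrancl trans_rtrancl) (auto simp: sym_def)

text \<open>Needed because \<open>Abs_fset\<close> is faithful only on finite sets: without finite
  classes, \<open>glue_class\<close> might fail to separate them.\<close>

lemma finite_glue_rel_Image:
  assumes "finite S" "inj_on h1 S" "inj_on h2 S"
  shows "finite (glue_rel S h1 h2 `` {x})"
proof (rule finite_subset)
  show "glue_rel S h1 h2 `` {x} \<subseteq> insert x (Inl ` h1 ` S \<union> Inr ` h2 ` S)"
    by (auto simp: glue_rel_eq assms)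
qed (simp add: assms)

section \<open>Arrows of \<open>HGr\<close> and the category laws\<close>

lemma Hom_HGr_iff:
  "f \<in> Hom HGr X Y \<longleftrightarrow> src f = X \<and> tgt f = Y \<and> finite_hypergraph X \<and> finite_hypergraph Y \<and>
     hypergraph_hom X Y (vmap f) \<and> inj_on (vmap f) (verts X) \<and> vmap f \<in> extensional (verts X)"
  by (auto simp: Hom_def HGr_def)

lemma Obj_HGr: "Obj HGr = {H. finite_hypergraph H}"
  by (simp add: HGr_def)

lemma Comp_HGr: "Comp HGr g f = Arrow (src f) (compose (verts (src f)) (vmap g) (vmap f)) (tgt g)"
  by (simp add: HGr_def)

text \<open>Outside \<open>verts X\<close> both maps are \<open>undefined\<close> by extensionality,
  so only their values on vertices matter.\<close>

lemma hg_arrow_eqI: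
  assumes "f \<in> Hom HGr X Y" "g \<in> Hom HGr X Y" "\<And>v. v \<in> verts X \<Longrightarrow> vmap f v = vmap g v"
  shows "f = g"
  using assms by (intro hg_arrow.expand) (auto simp: Hom_HGr_iff intro: extensionalityI)

lemma vmap_in_verts: "f \<in> Hom HGr X Y \<Longrightarrow> v \<in> verts X \<Longrightarrow> vmap f v \<in> verts Y"
  by (auto simp: Hom_HGr_iff hypergraph_hom_def)

lemma edge_subset_verts: "finite_hypergraph H \<Longrightarrow> F \<in> edges H \<Longrightarrow> F \<subseteq> verts H"
  by (auto simp: finite_hypergraph_def)

lemma vmap_edge:
  "f \<in> Hom HGr X Y \<Longrightarrow> F \<in> edges X \<Longrightarrow> vmap f ` F \<in> edges Y"
  by (auto simp: Hom_HGr_iff hypergraph_hom_def)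

text \<open>Allows an arrow to be built from a map given by any convenient formula: edges lie inside
  \<open>verts X\<close>, so restricting the map does not change their images.\<close>

lemma HomI_HGr:
  assumes "finite_hypergraph X" "finite_hypergraph Y"
    and "\<And>v. v \<in> verts X \<Longrightarrow> f v \<in> verts Y"
    and "\<And>F. F \<in> edges X \<Longrightarrow> f ` F \<in> edges Y"
    and "inj_on f (verts X)"
  shows "Arrow X (restrict f (verts X)) Y \<in> Hom HGr X Y"
proof -
  have "restrict f (verts X) ` F \<in> edges Y" if "F \<in> edges X" for F
  proof -
    have "restrict f (verts X) ` F = f ` F"
      using edge_subset_verts[OF assms(1) that] by (intro image_cong) auto
    then show ?thesis using assms(4) that by simp
  qed
  then show ?thesis
    using assms by (auto simp: Hom_HGr_iff hypergraph_hom_def inj_on_def)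
qed

lemma Comp_Hom_HGr:
  assumes f: "f \<in> Hom HGr X Y" and g: "g \<in> Hom HGr Y Z"
  shows "Comp HGr g f \<in> Hom HGr X Z"
proof -
  have "Arrow X (restrict (vmap g \<circ> vmap f) (verts X)) Z \<in> Hom HGr X Z"
  proof (rule HomI_HGr)
    show "inj_on (vmap g \<circ> vmap f) (verts X)"
      using f g vmap_in_verts[OF f]
      by (intro comp_inj_on) (auto simp: Hom_HGr_iff intro: inj_on_subset)
    show "(vmap g \<circ> vmap f) ` F \<in> edges Z" if "F \<in> edges X" for F
      using vmap_edge[OF g vmap_edge[OF f that]] by (simp add: image_comp)
  qed (use f g in \<open>auto simp: vmap_in_verts[OF f] vmap_in_verts[OF g] Hom_HGr_iff\<close>)
  then show ?thesis
    using f g by (simp add: Comp_HGr compose_def Hom_HGr_iff o_def)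
qed

lemma Id_Hom_HGr: "finite_hypergraph X \<Longrightarrow> Id HGr X \<in> Hom HGr X X"
  using HomI_HGr[of X X "\<lambda>v. v"] by (simp add: HGr_def)

lemma category_HGr: "category HGr"
proof
  fix f :: "'a vertex hg_arrow" and X Y
  assume f: "f \<in> Hom HGr X Y"
  then have X: "Id HGr X \<in> Hom HGr X X" and Y: "Id HGr Y \<in> Hom HGr Y Y"
    by (simp_all add: Hom_HGr_iff[of f] Id_Hom_HGr)
  show "f \<cdot>\<^bsub>HGr\<^esub> Id HGr X = f"
    using f by (intro hg_arrow_eqI[OF Comp_Hom_HGr[OF X f] f])
      (simp add: HGr_def compose_def)
  show "Id HGr Y \<cdot>\<^bsub>HGr\<^esub> f = f"
    using f vmap_in_verts[OF f] by (intro hg_arrow_eqI[OF Comp_Hom_HGr[OF f Y] f])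
      (auto simp: HGr_def compose_def Hom_def)
next
  fix f g h :: "'a vertex hg_arrow" and W X Y Z
  assume f: "f \<in> Hom HGr W X" and g: "g \<in> Hom HGr X Y" and h: "h \<in> Hom HGr Y Z"
  show "h \<cdot>\<^bsub>HGr\<^esub> (g \<cdot>\<^bsub>HGr\<^esub> f) = (h \<cdot>\<^bsub>HGr\<^esub> g) \<cdot>\<^bsub>HGr\<^esub> f"
    using f g vmap_in_verts[OF f]
    by (intro hg_arrow_eqI[OF Comp_Hom_HGr[OF Comp_Hom_HGr[OF f g] h]
          Comp_Hom_HGr[OF f Comp_Hom_HGr[OF g h]]])
      (auto simp: Comp_HGr compose_def Hom_def HGr_def)
next
  fix X :: "'a vertex hypergraph"
  assume "X \<in> Obj HGr"
  then show "Id HGr X \<in> Hom HGr X X"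
    by (simp add: Obj_HGr Id_Hom_HGr)
qed (auto intro: Comp_Hom_HGr, auto simp: HGr_def)

section \<open>Vertices and edges of the glued hypergraph\<close>

lemma glue_class_eq_iff:
  assumes "g \<in> Hom HGr X G" "h \<in> Hom HGr X H"
  shows "glue_class g h x = glue_class g h y \<longleftrightarrow> (x, y) \<in> glue_rel (verts X) (vmap g) (vmap h)"
proof -
  have "finite (glue_rel (verts X) (vmap g) (vmap h) `` {z})" for z
    using assms by (intro finite_glue_rel_Image) (auto simp: Hom_HGr_iff finite_hypergraph_def)
  \<comment> \<open>\<open>Class\<close> is a constructor and \<open>Abs_fset\<close> is injective
    on finite sets, so equal codes mean equal equivalence classes.\<close>
  then have "glue_class g h x = glue_class g h y \<longleftrightarrow>
      glue_rel (verts X) (vmap g) (vmap h) `` {x} = glue_rel (verts X) (vmap g) (vmap h) `` {y}"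
    using assms by (simp add: glue_class_def Abs_fset_inject Hom_HGr_iff)
  then show ?thesis
    by (simp add: eq_equiv_class_iff[OF equiv_glue_rel])
qed

text \<open>Read off from the explicit form of the relation in \<open>glue_rel_eq\<close>, which
  applies since both legs are injective. Later arguments about coinciding vertices of the quotient
  rest on these cases.\<close>

lemma glue_class_eq_simps:
  assumes "g \<in> Hom HGr X G" "h \<in> Hom HGr X H"
  shows "glue_class g h (Inl a) = glue_class g h (Inl a') \<longleftrightarrow> a = a'"
    and "glue_class g h (Inr b) = glue_class g h (Inr b') \<longleftrightarrow> b = b'"
    and "glue_class g h (Inl a) = glue_class g h (Inr b) \<longleftrightarrow>
      (\<exists>v\<in>verts X. a = vmap g v \<and> b = vmap h v)"
    and "glue_class g h (Inr b) = glue_class g h (Inl a) \<longleftrightarrow>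
      (\<exists>v\<in>verts X. a = vmap g v \<and> b = vmap h v)"
  using assms by (auto simp: glue_class_eq_iff[OF assms] glue_rel_eq Hom_HGr_iff)

lemma glue_class_in_verts_glue:
  assumes "g \<in> Hom HGr X G" "h \<in> Hom HGr X H"
  shows "a \<in> verts G \<Longrightarrow> glue_class g h (Inl a) \<in> verts (glue g h)"
    and "b \<in> verts H \<Longrightarrow> glue_class g h (Inr b) \<in> verts (glue g h)"
  using assms by (auto simp: glue_def Hom_HGr_iff)

lemma glue_class_edge_glue:
  assumes "g \<in> Hom HGr X G" "h \<in> Hom HGr X H"
  shows "F \<in> edges G \<Longrightarrow> (\<lambda>a. glue_class g h (Inl a)) ` F \<in> edges (glue g h)"
    and "F \<in> edges H \<Longrightarrow> (\<lambda>b. glue_class g h (Inr b)) ` F \<in> edges (glue g h)"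
  using assms by (auto simp: glue_def Hom_HGr_iff image_image)

text \<open>Joint surjectivity of the two legs, in the form of a case distinction on a
  representative.\<close>

lemma verts_glueE:
  assumes "g \<in> Hom HGr X G" "h \<in> Hom HGr X H" "u \<in> verts (glue g h)"
  obtains (left) a where "a \<in> verts G" "u = glue_class g h (Inl a)"
    | (right) b where "b \<in> verts H" "u = glue_class g h (Inr b)"
  using assms by (auto simp: glue_def Hom_HGr_iff)

lemma edges_glueE:
  assumes "g \<in> Hom HGr X G" "h \<in> Hom HGr X H" "E \<in> edges (glue g h)"
  obtains (left) F where "F \<in> edges G" "E = (\<lambda>a. glue_class g h (Inl a)) ` F"
    | (right) F where "F \<in> edges H" "E = (\<lambda>b. glue_class g h (Inr b)) ` F"
  using assms by (auto simp: glue_def Hom_HGr_iff image_image)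

lemma finite_hypergraph_glue:
  assumes "g \<in> Hom HGr X G" "h \<in> Hom HGr X H"
  shows "finite_hypergraph (glue g h)"
proof -
  have GH: "finite_hypergraph G" "finite_hypergraph H"
    using assms by (auto simp: Hom_HGr_iff)
  have "finite (verts (glue g h))"
    using assms by (auto simp: glue_def Hom_HGr_iff finite_hypergraph_def)
  moreover have "E \<subseteq> verts (glue g h)" if "E \<in> edges (glue g h)" for E
    using assms that
    by (cases rule: edges_glueE)
      (auto dest: edge_subset_verts[OF GH(1)] edge_subset_verts[OF GH(2)]
        intro!: glue_class_in_verts_glue[OF assms])
  ultimately show ?thesis
    by (auto simp: finite_hypergraph_def)
qed

section \<open>The legs form a commuting cocone in \<open>HGr\<close>\<close>

lemma leg1_Hom_HGr:
  assumes "g \<in> Hom HGr X G" "h \<in> Hom HGr X H"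
  shows "leg1 (PHGr g h) \<in> Hom HGr G (glue g h)"
proof -
  have "Arrow G (\<lambda>a\<in>verts G. glue_class g h (Inl a)) (glue g h) \<in> Hom HGr G (glue g h)"
    \<comment> \<open>This leg is injective because \<open>h\<close> is: passing from
      \<open>Inl a\<close> to some \<open>Inr b\<close> and back, the vertex \<open>b\<close> has
      only one preimage under \<open>h\<close>, so the way back ends at \<open>a\<close>.\<close>
    using assms by (intro HomI_HGr finite_hypergraph_glue)
      (auto simp: glue_class_in_verts_glue glue_class_edge_glue glue_class_eq_simps inj_on_def
        Hom_HGr_iff[of g])
  then show ?thesis
    using assms by (simp add: PHGr_def Hom_HGr_iff)
qed

lemma leg2_Hom_HGr:
  assumes "g \<in> Hom HGr X G" "h \<in> Hom HGr X H"
  shows "leg2 (PHGr g h) \<in> Hom HGr H (glue g h)"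
proof -
  have "Arrow H (\<lambda>b\<in>verts H. glue_class g h (Inr b)) (glue g h) \<in> Hom HGr H (glue g h)"
    using assms by (intro HomI_HGr finite_hypergraph_glue)
      (auto simp: glue_class_in_verts_glue glue_class_edge_glue glue_class_eq_simps inj_on_def
        Hom_HGr_iff[of h])
  then show ?thesis
    using assms by (simp add: PHGr_def Hom_HGr_iff)
qed

lemma legs_commute_HGr:
  assumes g: "g \<in> Hom HGr X G" and h: "h \<in> Hom HGr X H"
  shows "Comp HGr (leg1 (PHGr g h)) g = Comp HGr (leg2 (PHGr g h)) h"
proof (rule hg_arrow_eqI)
  show "Comp HGr (leg1 (PHGr g h)) g \<in> Hom HGr X (glue g h)"
    by (rule Comp_Hom_HGr[OF g leg1_Hom_HGr[OF g h]])
  show "Comp HGr (leg2 (PHGr g h)) h \<in> Hom HGr X (glue g h)"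
    by (rule Comp_Hom_HGr[OF h leg2_Hom_HGr[OF g h]])
  show "vmap (Comp HGr (leg1 (PHGr g h)) g) v = vmap (Comp HGr (leg2 (PHGr g h)) h) v"
    if "v \<in> verts X" for v
    using that g h vmap_in_verts[OF g that] vmap_in_verts[OF h that]
    by (auto simp: Comp_HGr PHGr_def compose_def Hom_HGr_iff[of g] Hom_HGr_iff[of h]
        glue_class_eq_simps[OF g h])
qed

section \<open>The spine and (SC1)\<close>

lemma finite_hypergraph_\<Omega>HGr: "finite_hypergraph (\<Omega>HGr n)"
  by (auto simp: finite_hypergraph_def \<Omega>HGr_def)

lemma ex_Hom_\<Omega>HGr:
  assumes "finite_hypergraph X"
  shows "\<exists>n f. f \<in> Hom HGr X (\<Omega>HGr n)"
proof -
  from assms have "finite (verts X)"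
    by (simp add: finite_hypergraph_def)
  from ex_bij_betw_finite_nat[OF this] obtain e
    where e: "bij_betw e (verts X) {0..<card (verts X)}" ..
  have "e v < card (verts X)" if "v \<in> verts X" for v
    using bij_betwE[OF e] that by auto
  \<comment> \<open>The enumeration \<open>e\<close> starts at 0 but the vertices of the spine at 1,
    hence the \<open>Suc\<close>.\<close>
  then have mem: "Num (Suc (e v)) \<in> Num ` {1..card (verts X)}" if "v \<in> verts X" for v
    using that by (auto simp: Suc_le_eq)
  have "Arrow X (\<lambda>v\<in>verts X. Num (Suc (e v))) (\<Omega>HGr (card (verts X)))
      \<in> Hom HGr X (\<Omega>HGr (card (verts X)))"
  proof (rule HomI_HGr[OF assms finite_hypergraph_\<Omega>HGr])
    show "inj_on (\<lambda>v. Num (Suc (e v))) (verts X)"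
      using e by (auto simp: bij_betw_def inj_on_def)
    \<comment> \<open>Every set of vertices of the spine object is an edge, so any map into its
      vertices preserves edges.\<close>
    show "(\<lambda>v. Num (Suc (e v))) ` F \<in> edges (\<Omega>HGr (card (verts X)))" if "F \<in> edges X" for F
      using edge_subset_verts[OF assms that] mem unfolding \<Omega>HGr_def
      by (auto simp del: image_eqI)
  qed (use mem in \<open>simp add: \<Omega>HGr_def\<close>)
  then show ?thesis
    by blast
qed

section \<open>The unique induced arrow of (SC2)\<close>

lemma ex1_glue_Hom:
  assumes g: "g \<in> Hom HGr X G" and h: "h \<in> Hom HGr X H"
    and g': "g' \<in> Hom HGr G G'" and h': "h' \<in> Hom HGr H H'"
  defines "p \<equiv> Comp HGr g' g" and "q \<equiv> Comp HGr h' h"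
  shows "\<exists>!k. k \<in> Hom HGr (glue g h) (glue p q) \<and>
    Comp HGr k (leg1 (PHGr g h)) = Comp HGr (leg1 (PHGr p q)) g' \<and>
    Comp HGr k (leg2 (PHGr g h)) = Comp HGr (leg2 (PHGr p q)) h'"
proof -
  have p: "p \<in> Hom HGr X G'" and q: "q \<in> Hom HGr X H'"
    unfolding p_def q_def by (rule Comp_Hom_HGr[OF g g'] Comp_Hom_HGr[OF h h'])+
  have vmap_pq: "vmap p v = vmap g' (vmap g v)" "vmap q v = vmap h' (vmap h v)"
    if "v \<in> verts X" for v
    using g h that by (auto simp: p_def q_def Comp_HGr compose_def Hom_HGr_iff)
  have inj_g': "vmap g' a = vmap g' a' \<longleftrightarrow> a = a'" if "a \<in> verts G" "a' \<in> verts G" for a a'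
    using g' that by (auto simp: Hom_HGr_iff dest: inj_onD)
  have inj_h': "vmap h' b = vmap h' b' \<longleftrightarrow> b = b'" if "b \<in> verts H" "b' \<in> verts H" for b b'
    using h' that by (auto simp: Hom_HGr_iff dest: inj_onD)
  note eq_gh = glue_class_eq_simps[OF g h] and eq_pq = glue_class_eq_simps[OF p q]
  \<comment> \<open>If \<open>vmap g' a = vmap p v\<close>, the right side is
    \<open>vmap g' (vmap g v)\<close>, and injectivity of \<open>g'\<close> cancels to
    \<open>a = vmap g v\<close>; likewise for \<open>h'\<close>. This one equivalence gives both
    well-definedness and injectivity of the induced map.\<close>
  have cross: "glue_class p q (Inl (vmap g' a)) = glue_class p q (Inr (vmap h' b)) \<longleftrightarrow>
      glue_class g h (Inl a) = glue_class g h (Inr b)" if "a \<in> verts G" "b \<in> verts H" for a b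
    using that vmap_in_verts[OF g] vmap_in_verts[OF h]
    by (auto simp: eq_gh eq_pq vmap_pq inj_g' inj_h')
  \<comment> \<open>A class with representatives on both sides is sent along its left one. Each
    \<open>THE\<close> is determined because the legs are injective.\<close>
  define f where "f u = (if u \<in> (\<lambda>a. glue_class g h (Inl a)) ` verts G
      then glue_class p q (Inl (vmap g' (THE a. u = glue_class g h (Inl a))))
      else glue_class p q (Inr (vmap h' (THE b. u = glue_class g h (Inr b)))))" for u
  have f_Inl: "f (glue_class g h (Inl a)) = glue_class p q (Inl (vmap g' a))"
    if "a \<in> verts G" for a
    using that by (simp add: f_def eq_gh)
  have f_Inr: "f (glue_class g h (Inr b)) = glue_class p q (Inr (vmap h' b))"
    if b: "b \<in> verts H" for b
  proof (cases "glue_class g h (Inr b) \<in> (\<lambda>a. glue_class g h (Inl a)) ` verts G")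
    \<comment> \<open>Here \<open>f\<close> uses the left representative, and \<open>cross\<close>
      shows that the right one gives the same value.\<close>
    case True
    then obtain a where "a \<in> verts G" "glue_class g h (Inr b) = glue_class g h (Inl a)"
      by blast
    then show ?thesis
      using f_Inl cross b by metis
  next
    case False
    then show ?thesis
      by (simp add: f_def eq_gh)
  qed
  have fin: "finite_hypergraph (glue g h)" "finite_hypergraph (glue p q)"
    using finite_hypergraph_glue[OF g h] finite_hypergraph_glue[OF p q] by auto
  have sub: "F \<in> edges G \<Longrightarrow> F \<subseteq> verts G" "F \<in> edges H \<Longrightarrow> F \<subseteq> verts H" for F
    using g h by (auto simp: Hom_HGr_iff dest: edge_subset_verts)
  define k where "k = Arrow (glue g h) (restrict f (verts (glue g h))) (glue p q)"
  have k: "k \<in> Hom HGr (glue g h) (glue p q)"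
    unfolding k_def
  proof (rule HomI_HGr[OF fin])
    show "f u \<in> verts (glue p q)" if "u \<in> verts (glue g h)" for u
      using g h that
      by (cases rule: verts_glueE)
        (simp_all add: f_Inl f_Inr glue_class_in_verts_glue[OF p q] vmap_in_verts[OF g']
          vmap_in_verts[OF h'])
    show "f ` E \<in> edges (glue p q)" if "E \<in> edges (glue g h)" for E
      using g h that
    proof (cases rule: edges_glueE)
      case (left F)
      \<comment> \<open>On classes from the left, \<open>f\<close> acts as \<open>g'\<close>, so an
        edge coming from \<open>F\<close> goes to the one coming from its image under
        \<open>g'\<close>.\<close>
      then have "f ` E = (\<lambda>a. glue_class p q (Inl a)) ` vmap g' ` F"
        using sub(1) by (auto simp: image_image f_Inl subset_iff intro!: image_cong)
      then show ?thesis
        using glue_class_edge_glue(1)[OF p q vmap_edge[OF g' left(1)]] by simp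
    next
      case (right F)
      then have "f ` E = (\<lambda>b. glue_class p q (Inr b)) ` vmap h' ` F"
        using sub(2) by (auto simp: image_image f_Inr subset_iff intro!: image_cong)
      then show ?thesis
        using glue_class_edge_glue(2)[OF p q vmap_edge[OF h' right(1)]] by simp
    qed
    show "inj_on f (verts (glue g h))"
    proof (rule inj_onI)
      fix u w
      assume "u \<in> verts (glue g h)" and w: "w \<in> verts (glue g h)" and fuw: "f u = f w"
      from g h this(1) show "u = w"
      proof (cases rule: verts_glueE)
        case u: (left a)
        \<comment> \<open>Two left representatives are settled by injectivity of \<open>g'\<close>,
          a mixed pair by \<open>cross\<close>.\<close>
        from g h w show ?thesis
          by (cases rule: verts_glueE)
            (use u fuw in \<open>auto simp: f_Inl f_Inr cross eq_pq(1,2) inj_g'\<close>)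
      next
        case u: (right b)
        \<comment> \<open>The equation is reversed below so that a mixed pair appears as
          \<open>Inl\<close> against \<open>Inr\<close>, the orientation of
          \<open>cross\<close>.\<close>
        from g h w show ?thesis
          by (cases rule: verts_glueE)
            (use u fuw[symmetric] in \<open>auto simp: f_Inl f_Inr cross eq_pq(1,2) inj_h'\<close>)
      qed
    qed
  qed
  \<comment> \<open>Stated for an arbitrary arrow \<open>m\<close>, so that it serves existence,
    with \<open>k\<close>, as well as uniqueness.\<close>
  have comm1: "Comp HGr m (leg1 (PHGr g h)) = Comp HGr (leg1 (PHGr p q)) g' \<longleftrightarrow>
      (\<forall>a\<in>verts G. vmap m (glue_class g h (Inl a)) = glue_class p q (Inl (vmap g' a)))"
    (is "?L = ?R \<longleftrightarrow> ?A")
    if m: "m \<in> Hom HGr (glue g h) (glue p q)" for m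
  proof -
    have "vmap ?L a = vmap m (glue_class g h (Inl a))"
      "vmap ?R a = glue_class p q (Inl (vmap g' a))" if "a \<in> verts G" for a
      using that g p g' vmap_in_verts[OF g' that]
      by (auto simp: Comp_HGr compose_def PHGr_def Hom_HGr_iff)
    then show ?thesis
      using hg_arrow_eqI[OF Comp_Hom_HGr[OF leg1_Hom_HGr[OF g h] m]
          Comp_Hom_HGr[OF g' leg1_Hom_HGr[OF p q]]] by metis
  qed
  have comm2: "Comp HGr m (leg2 (PHGr g h)) = Comp HGr (leg2 (PHGr p q)) h' \<longleftrightarrow>
      (\<forall>b\<in>verts H. vmap m (glue_class g h (Inr b)) = glue_class p q (Inr (vmap h' b)))"
    (is "?L = ?R \<longleftrightarrow> ?A")
    if m: "m \<in> Hom HGr (glue g h) (glue p q)" for m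
  proof -
    have "vmap ?L b = vmap m (glue_class g h (Inr b))"
      "vmap ?R b = glue_class p q (Inr (vmap h' b))" if "b \<in> verts H" for b
      using that h q h' vmap_in_verts[OF h' that]
      by (auto simp: Comp_HGr compose_def PHGr_def Hom_HGr_iff)
    then show ?thesis
      using hg_arrow_eqI[OF Comp_Hom_HGr[OF leg2_Hom_HGr[OF g h] m]
          Comp_Hom_HGr[OF h' leg2_Hom_HGr[OF p q]]] by metis
  qed
  show ?thesis
  proof (intro ex1I[of _ k] conjI)
    show "Comp HGr k (leg1 (PHGr g h)) = Comp HGr (leg1 (PHGr p q)) g'"
      by (simp add: comm1[OF k]) (simp add: k_def f_Inl glue_class_in_verts_glue[OF g h])
    show "Comp HGr k (leg2 (PHGr g h)) = Comp HGr (leg2 (PHGr p q)) h'"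
      by (simp add: comm2[OF k]) (simp add: k_def f_Inr glue_class_in_verts_glue[OF g h])
  next
    fix m
    assume "m \<in> Hom HGr (glue g h) (glue p q) \<and>
      Comp HGr m (leg1 (PHGr g h)) = Comp HGr (leg1 (PHGr p q)) g' \<and>
      Comp HGr m (leg2 (PHGr g h)) = Comp HGr (leg2 (PHGr p q)) h'"
    then have m: "m \<in> Hom HGr (glue g h) (glue p q)"
      and mG: "\<forall>a\<in>verts G. vmap m (glue_class g h (Inl a)) = glue_class p q (Inl (vmap g' a))"
      and mH: "\<forall>b\<in>verts H. vmap m (glue_class g h (Inr b)) = glue_class p q (Inr (vmap h' b))"
      using comm1 comm2 by blast+
    show "m = k"
    \<comment> \<open>Every vertex of the quotient has a representative, on which \<open>mG\<close>
      or \<open>mH\<close> prescribes the value of \<open>m\<close>.\<close>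
    proof (rule hg_arrow_eqI[OF m k])
      fix u
      assume u: "u \<in> verts (glue g h)"
      from g h u show "vmap m u = vmap k u"
        by (cases rule: verts_glueE)
          (use u mG mH in \<open>auto simp: k_def f_Inl f_Inr\<close>)
    qed
  qed (rule k)
qed

theorem theorem5p2:
  "spined_category
     (HGr :: ('a vertex hypergraph, 'a vertex hg_arrow) category) \<Omega>HGr PHGr"
proof -
  interpret category "HGr :: ('a vertex hypergraph, 'a vertex hg_arrow) category"
    by (rule category_HGr)
  \<comment> \<open>Rewriting the apex to \<open>glue g h\<close> brings the axioms into the form in
    which the lemmas are stated.\<close>
  have apex: "apex (PHGr g h) = glue g h" for g h :: "'a vertex hg_arrow"
    by (simp add: PHGr_def)
  show ?thesis
    by unfold_locales
      (simp_all add: Obj_HGr apex finite_hypergraph_\<Omega>HGr finite_hypergraph_glue leg1_Hom_HGr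
        leg2_Hom_HGr legs_commute_HGr ex_Hom_\<Omega>HGr ex1_glue_Hom)
qed

end
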